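(* Let $V$ be a finite set with a total order $\prec$ and let $\mathcal{L}$ be an independent hypergraph with its vertices in $V$. Let $t,s\geq 0$ be integers and let $m\in \mathbb{Z}$. Suppose $m=\lambda(2t+1)+q$ where $\lambda\in \mathbb{Z}$ and $0\leq q\leq 2t$. Then for any $\omega\in \mathrm{Ext}^{2t+1}(V)$ and $\mu\in \mathrm{Ext}^{2s}(V)$, there is a homomorphism $$\mu_*:\ H^n(\mathcal{L},\omega,m)\longrightarrow H^n(\mathcal{L},\omega,m+2s),\qquad n\geq 0,$$ of the constrained cohomology groups, induced by $\mu$ (i.e. sending the class of a co-cycle $x$ to the class of $\mu(x)$).
   Context: For $n\ge 0$, $\Lambda_n(V)$ is the real vector space with basis the elementary $n$-paths on $V$, i.e. all ordered sequences $v_0v_1\ldots v_n$ of $n+1$ vertices of $V$ (repetitions allowed, no order condition); $\Lambda_k(V)=0$ for $k<0$. For $v\in V$, the linear map $\frac{\partial}{\partial v}:\Lambda_n(V)\to\Lambda_{n-1}(V)$ is given by $\frac{\partial}{\partial v}(v_0\ldots v_n)=\sum_{i=0}^n(-1)^i\delta(v,v_i)\,v_0\ldots\widehat{v_i}\ldots v_n$ (with $\delta(u,v)=1$ if $u=v$, and $0$ otherwise), and $dv:\Lambda_n(V)\to\Lambda_{n+1}(V)$ ($n\ge 0$) is its adjoint with respect to the inner products for which the elementary paths are orthonormal; explicitly $dv(u_0\ldots u_n)=\sum_{i=0}^{n+1}(-1)^iu_0\ldots u_{i-1}\,v\,u_i\ldots u_n$. One has $du\circ dv=-dv\circ du$.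 $\mathrm{Ext}^*(V)=\bigoplus_{k\ge0}\mathrm{Ext}^k(V)$ is the real exterior algebra generated by the $dv$, $v\in V$ ($\mathrm{Ext}^0(V)=\mathbb{R}$ acts by scalars), with product $\wedge$ the composition of linear maps, so an element of $\mathrm{Ext}^k(V)$ acts as linear maps $\Lambda_n(V)\to\Lambda_{n+k}(V)$ (zero on $\Lambda_n(V)=0$ for $n<0$). An $n$-hyperedge on $V$ is a sequence $v_0v_1\ldots v_n$ of vertices with $v_0\prec v_1\prec\cdots\prec v_n$, identified with the set $\{v_0,\ldots,v_n\}$. An independent hypergraph $\mathcal{L}$ with vertices in $V$ is a set of hyperedges on $V$ such that if $\sigma\in\mathcal{L}$ and $\tau$ is a hyperedge on $V$ with $\sigma\subseteq\tau$, then $\tau\in\mathcal{L}$. $C_n(\mathcal{L};\mathbb{R})\subseteq\Lambda_n(V)$ is the real vector space of linear combinations of the $n$-hyperedges in $\mathcal{L}$; it is $0$ for $n<0$. An elementary $n$-path $v_0\ldots v_n$ is non-simplicial if $v_j\prec v_i$ or $v_j=v_i$ for some $i<j$. Elements of $\mathrm{Ext}^*(V)$ act on $C_*(\mathcal{L};\mathbb{R})$ modulo non-simplicial paths, i.e. by applying the map on $\Lambda_*(V)$ and then killing all non-simplicial elementary paths (the result again lies in $C_*(\mathcal{L};\mathbb{R})$). Given $t\ge0$, each integer $m$ is written uniquely as $m=\lambda(2t+1)+q$ with $\lambda\in\mathbb{Z}$, $0\le q\le 2t$. For $\omega\in\mathrm{Ext}^{2t+1}(V)$, $C^*(\mathcal{L},\omega,m)$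 is the co-chain complex with degree-$n$ term $C_{(n+\lambda)(2t+1)+q}(\mathcal{L};\mathbb{R})$, $n\ge0$, and co-boundary map $\omega$ (so the term before degree $n=0$ is $0$). The $n$-th constrained cohomology group of $\mathcal{L}$ with respect to $\omega$ and $m$ is $H^n(\mathcal{L},\omega,m)=H^n(C^*(\mathcal{L},\omega,m))$, i.e. the kernel of $\omega$ on the degree-$n$ term modulo the image of $\omega$ from the degree-$(n-1)$ term. *)

theory Defs
  imports Complex_Main "HOL-Library.Poly_Mapping" "HOL-Algebra.Coset"
begin

text \<open>An elementary \<open>n\<close>-path \<open>v\<^sub>0\<dots>v\<^sub>n\<close> is a list of length \<open>n + 1\<close>; a chain is a formal real
  combination of lists. The empty list is not a path, and the spaces of chains below exclude it.
  The total order on the vertices is given by its strict relation: \<open>(u, v) \<in> r\<close> means that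
  \<open>u\<close> precedes \<open>v\<close>.\<close>

type_synonym 'a chain = "'a list \<Rightarrow>\<^sub>0 real"

definition scale :: "real \<Rightarrow> 'a chain \<Rightarrow> 'a chain" where
  "scale c x = Poly_Mapping.map ((*) c) x"

text \<open>The linear extension of
  \<open>dv (u\<^sub>0\<dots>u\<^sub>n) = (\<Sum>i = 0..n+1. (-1)\<^sup>i u\<^sub>0\<dots>u\<^bsub>i-1\<^esub> v u\<^sub>i\<dots>u\<^sub>n)\<close>.\<close>

definition dv :: "'a \<Rightarrow> 'a chain \<Rightarrow> 'a chain" where
  "dv v x = (\<Sum>u\<in>Poly_Mapping.keys x. \<Sum>i\<le>length u.
     Poly_Mapping.single (take i u @ v # drop i u) ((-1) ^ i * Poly_Mapping.lookup x u))"

text \<open>\<open>ext_power V k\<close> is the linear span of the compositions \<open>dv\<^sub>1 \<circ> \<dots> \<circ> dv\<^sub>k\<close>, where \<open>foldr dv [v\<^sub>1,\<dots>,v\<^sub>k]\<close>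
  is such a composition. For finite \<open>V\<close> (the only case of interest) the sum is finite.
  For \<open>k = 0\<close> it consists of the scalars.\<close>

definition ext_power :: "'a set \<Rightarrow> nat \<Rightarrow> ('a chain \<Rightarrow> 'a chain) set" where
  "ext_power V k =
     {\<omega>. \<exists>c. \<omega> = (\<lambda>x. \<Sum>vs | set vs \<subseteq> V \<and> length vs = k. scale (c vs) (foldr dv vs x))}"

definition hyperedges :: "'a set \<Rightarrow> 'a rel \<Rightarrow> 'a list set" where
  "hyperedges V r = {\<sigma>. \<sigma> \<noteq> [] \<and> set \<sigma> \<subseteq> V \<and> sorted_wrt (\<lambda>u v. (u, v) \<in> r) \<sigma>}"

definition independent_hypergraph :: "'a set \<Rightarrow> 'a rel \<Rightarrow> 'a list set \<Rightarrow> bool" where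
  "independent_hypergraph V r L \<longleftrightarrow> L \<subseteq> hyperedges V r \<and>
     (\<forall>\<sigma>\<in>L. \<forall>\<tau>\<in>hyperedges V r. set \<sigma> \<subseteq> set \<tau> \<longrightarrow> \<tau> \<in> L)"

definition non_simplicial :: "'a rel \<Rightarrow> 'a list \<Rightarrow> bool" where
  "non_simplicial r p \<longleftrightarrow>
     (\<exists>i j. i < j \<and> j < length p \<and> ((p ! j, p ! i) \<in> r \<or> p ! j = p ! i))"

definition kill_non_simplicial :: "'a rel \<Rightarrow> 'a chain \<Rightarrow> 'a chain" where
  "kill_non_simplicial r x = Poly_Mapping.mapp (\<lambda>p a. if non_simplicial r p then 0 else a) x"

definition ext_action :: "'a rel \<Rightarrow> ('a chain \<Rightarrow> 'a chain) \<Rightarrow> 'a chain \<Rightarrow> 'a chain" where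
  "ext_action r \<omega> x = kill_non_simplicial r (\<omega> x)"

text \<open>\<open>C\<^sub>n(L; \<real>)\<close>, for integer \<open>n\<close>.\<close>

definition chains :: "'a list set \<Rightarrow> int \<Rightarrow> 'a chain set" where
  "chains L n = {x. Poly_Mapping.keys x \<subseteq> {\<sigma> \<in> L. \<sigma> \<noteq> [] \<and> int (length \<sigma>) = n + 1}}"

text \<open>In the definitions below \<open>\<omega>\<close> is meant to be in \<open>ext_power V (2 * t + 1)\<close>. In the
  decomposition \<open>m = \<lambda> (2 t + 1) + q\<close> with \<open>0 \<le> q \<le> 2 t\<close> one has
  \<open>\<lambda> = m div (2 t + 1)\<close> and \<open>q = m mod (2 t + 1)\<close>.\<close>

definition cochain_space :: "'a list set \<Rightarrow> nat \<Rightarrow> int \<Rightarrow> nat \<Rightarrow> 'a chain set" where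
  "cochain_space L t m n =
     (let d = 2 * int t + 1 in chains L ((int n + m div d) * d + m mod d))"

definition cocycles ::
  "'a rel \<Rightarrow> 'a list set \<Rightarrow> nat \<Rightarrow> ('a chain \<Rightarrow> 'a chain) \<Rightarrow> int \<Rightarrow> nat \<Rightarrow> 'a chain set" where
  "cocycles r L t \<omega> m n = {x \<in> cochain_space L t m n. ext_action r \<omega> x = 0}"

definition coboundaries ::
  "'a rel \<Rightarrow> 'a list set \<Rightarrow> nat \<Rightarrow> ('a chain \<Rightarrow> 'a chain) \<Rightarrow> int \<Rightarrow> nat \<Rightarrow> 'a chain set" where
  "coboundaries r L t \<omega> m n =
     (case n of 0 \<Rightarrow> {0} | Suc k \<Rightarrow> ext_action r \<omega> ` cochain_space L t m k)"

definition cocycle_group ::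
  "'a rel \<Rightarrow> 'a list set \<Rightarrow> nat \<Rightarrow> ('a chain \<Rightarrow> 'a chain) \<Rightarrow> int \<Rightarrow> nat \<Rightarrow> 'a chain monoid" where
  "cocycle_group r L t \<omega> m n = \<lparr>carrier = cocycles r L t \<omega> m n, mult = (+), one = 0\<rparr>"

definition constrained_cohomology ::
  "'a rel \<Rightarrow> 'a list set \<Rightarrow> nat \<Rightarrow> ('a chain \<Rightarrow> 'a chain) \<Rightarrow> int \<Rightarrow> nat \<Rightarrow> 'a chain set monoid" where
  "constrained_cohomology r L t \<omega> m n =
     cocycle_group r L t \<omega> m n Mod coboundaries r L t \<omega> m n"

definition cohomology_class ::
  "'a rel \<Rightarrow> 'a list set \<Rightarrow> nat \<Rightarrow> ('a chain \<Rightarrow> 'a chain) \<Rightarrow> int \<Rightarrow> nat \<Rightarrow> 'a chain \<Rightarrow> 'a chain set" where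
  "cohomology_class r L t \<omega> m n x =
     coboundaries r L t \<omega> m n #>\<^bsub>cocycle_group r L t \<omega> m n\<^esub> x"

end

theory Submission
  imports Defs
begin

text \<open>The maps \<open>dv\<close> anticommute, so an element of \<open>Ext\<^sup>j\<close> and one of \<open>Ext\<^sup>k\<close> commute up to the
  sign \<open>(-1)\<^bsup>jk\<^esup>\<close>. Inserting vertices into a non-simplicial path leaves it non-simplicial, so
  killing these paths is compatible with composition and the sign rule passes to the action on
  \<open>C\<^sub>*(L; \<real>)\<close>. Hence \<open>\<omega>\<close>, of odd degree, squares to zero and commutes with \<open>\<mu>\<close>, of even degree;
  so \<open>\<mu>\<close> is a cochain map. It raises path length by \<open>2s\<close>, which turns \<open>m\<close> into \<open>m + 2s\<close> since the
  degree-\<open>n\<close> term is \<open>C\<^bsub>n(2t+1)+m\<^esub>(L; \<real>)\<close>.\<close>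

text \<open>The coefficient of \<open>dv\<close> of a chain at a path \<open>w\<close> is the value of the chain, as a linear form,
  on \<open>\<partial>w/\<partial>v\<close>; in this adjoint form \<open>dv\<close> is a structural recursion over \<open>w\<close>.\<close>

primrec dv_coeff :: "'a \<Rightarrow> ('a list \<Rightarrow> real) \<Rightarrow> 'a list \<Rightarrow> real" where
  "dv_coeff v f [] = 0"
| "dv_coeff v f (a # w) = (if a = v then f w else 0) - dv_coeff v (\<lambda>w. f (a # w)) w"

section \<open>Linearity, locality and anticommutation of the coefficient recursion\<close>

lemma dv_coeff_diff: "dv_coeff v (\<lambda>w. f w - g w) w = dv_coeff v f w - dv_coeff v g w"
  by (induction w arbitrary: f g) auto

lemma dv_coeff_add: "dv_coeff v (\<lambda>w. f w + g w) w = dv_coeff v f w + dv_coeff v g w"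
  by (induction w arbitrary: f g) auto

lemma dv_coeff_mult: "dv_coeff v (\<lambda>w. c * f w) w = c * dv_coeff v f w"
  by (induction w arbitrary: f) (auto simp: algebra_simps)

text \<open>The recursion reads its form only at paths obtained from \<open>w\<close> by deleting
  one occurrence of \<open>v\<close>. This locality later controls supports and makes early killing
  harmless.\<close>

lemma dv_coeff_cong:
  assumes "\<And>w1 w2. w = w1 @ v # w2 \<Longrightarrow> f (w1 @ w2) = g (w1 @ w2)"
  shows "dv_coeff v f w = dv_coeff v g w"
  using assms
proof (induction w arbitrary: f g)
  case (Cons a w)
  have "dv_coeff v (\<lambda>w. f (a # w)) w = dv_coeff v (\<lambda>w. g (a # w)) w"
    using Cons.prems[of "a # _"] by (intro Cons.IH) simp
  moreover have "f w = g w" if "a = v"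
    using Cons.prems[of "[]" w] that by simp
  ultimately show ?case by simp
qed simp

text \<open>Unfolding both recursions at \<open>a # w\<close> leaves two terms, for
  \<open>a = u\<close> and \<open>a = v\<close>, that are exchanged with opposite signs when
  \<open>u\<close> and \<open>v\<close> swap, plus a term on \<open>w\<close> covered by
  induction.\<close>

lemma dv_coeff_anticommute: "dv_coeff u (dv_coeff v f) w = - dv_coeff v (dv_coeff u f) w"
proof (induction w arbitrary: f)
  case (Cons a w)
  \<comment> \<open>The test \<open>a = v\<close> is independent of the path, so it moves out of the
    recursion; factor 0 in \<open>dv_coeff_mult\<close> shows that the zero form is sent to
    0.\<close>
  have *: "dv_coeff u (\<lambda>w. (if a = v then f w else 0) - g w) w =
      (if a = v then dv_coeff u f w else 0) - dv_coeff u g w" for u v f g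
    using dv_coeff_mult[of u 0 f w] by (auto simp: dv_coeff_diff[of u f g])
      (simp add: dv_coeff_diff[of u "\<lambda>_. 0" g, simplified])
  show ?case by (simp add: * Cons.IH)
qed simp

section \<open>Agreement of the recursion with the signed sum over insertions\<close>

definition ins_coeff :: "'a \<Rightarrow> 'a list \<Rightarrow> 'a list \<Rightarrow> real" where
  "ins_coeff v u w = (\<Sum>i\<le>length u. if take i u @ v # drop i u = w then (-1) ^ i else 0)"

lemma ins_coeff_Nil: "ins_coeff v u [] = 0"
  by (simp add: ins_coeff_def)

text \<open>Insertion at position 0 gives the first term. Any later insertion keeps the head of
  \<open>u\<close> and is an insertion into its tail with index lowered by one, hence the minus
  sign.\<close>

lemma ins_coeff_Cons:
  "ins_coeff v u (a # w) = (if a = v \<and> u = w then 1 else 0)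
     - (case u of [] \<Rightarrow> 0 | b # u' \<Rightarrow> if b = a then ins_coeff v u' w else 0)"
proof (cases u)
  case (Cons b u')
  show ?thesis
    unfolding ins_coeff_def Cons
    by (auto simp: sum.atMost_Suc_shift sum_negf[symmetric] simp del: sum.atMost_Suc intro!: sum.cong)
qed (auto simp: ins_coeff_def)

text \<open>Matching the two recursions proves the adjointness. \<open>A\<close> may be any finite
  set containing the support, so that the induction can pass to the tails of its paths.\<close>

lemma dv_coeff_eq_sum:
  assumes "finite A" "\<And>u. f u \<noteq> 0 \<Longrightarrow> u \<in> A"
  shows "dv_coeff v f w = (\<Sum>u\<in>A. f u * ins_coeff v u w)"
  using assms
proof (induction w arbitrary: f A)
  case (Cons a w)
  let ?B = "{u. a # u \<in> A}"
  have B: "(\<lambda>u. a # u) ` ?B \<subseteq> A" by auto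
  have finB: "finite ?B"
    using finite_subset[OF B Cons.prems(1)] by (simp add: finite_image_iff)
  have "dv_coeff v (\<lambda>w. f (a # w)) w = (\<Sum>u\<in>?B. f (a # u) * ins_coeff v u w)"
    using Cons.prems finB by (intro Cons.IH) auto
  also have "\<dots> = (\<Sum>u\<in>(\<lambda>u. a # u) ` ?B. f u * ins_coeff v (tl u) w)"
    by (subst sum.reindex) auto
  also have "\<dots> = (\<Sum>u\<in>A. f u * (case u of [] \<Rightarrow> 0 | b # u' \<Rightarrow> if b = a then ins_coeff v u' w else 0))"
    using Cons.prems(1) B by (intro sum.mono_neutral_cong_left) (auto split: list.split)
  finally have 1: "dv_coeff v (\<lambda>w. f (a # w)) w = \<dots>" .
  have 2: "(if a = v then f w else 0) = (\<Sum>u\<in>A. f u * (if a = v \<and> u = w then 1 else 0))"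
    using Cons.prems by (auto simp: if_distrib cong: if_cong)
  show ?case
    by (simp add: 1 2 ins_coeff_Cons right_diff_distrib sum_subtractf)
qed (simp add: ins_coeff_Nil)

section \<open>Chains as a real vector space; linearity and supports of compositions of
  \<open>dv\<close>\<close>

lemma lookup_scale: "Poly_Mapping.lookup (scale c x) = (\<lambda>w. c * Poly_Mapping.lookup x w)"
  by (auto simp: scale_def Poly_Mapping.map.rep_eq when_def)

lemma lookup_dv: "Poly_Mapping.lookup (dv v x) = dv_coeff v (Poly_Mapping.lookup x)"
proof
  fix w
  have "Poly_Mapping.lookup (dv v x) w =
      (\<Sum>u\<in>Poly_Mapping.keys x. Poly_Mapping.lookup x u * ins_coeff v u w)"
    by (auto simp: dv_def lookup_sum lookup_single ins_coeff_def when_def sum_distrib_left intro!: sum.cong)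
  also have "\<dots> = dv_coeff v (Poly_Mapping.lookup x) w"
    by (rule dv_coeff_eq_sum[symmetric]) (auto simp: in_keys_iff)
  finally show "Poly_Mapping.lookup (dv v x) w = \<dots>" .
qed

lemma lookup_kill:
  "Poly_Mapping.lookup (kill_non_simplicial r x) w = (if non_simplicial r w then 0 else Poly_Mapping.lookup x w)"
  by (auto simp: kill_non_simplicial_def Poly_Mapping.mapp.rep_eq when_def in_keys_iff)

interpretation chain: vector_space scale
  by unfold_locales (auto intro!: poly_mapping_eqI simp: lookup_scale lookup_add algebra_simps)

lemma chain_linearI:
  assumes "\<And>x y. f (x + y) = f x + f y" "\<And>c x. f (scale c x) = scale c (f x)"
  shows "module_hom scale scale f"
  using assms by unfold_locales auto

lemma linear_dv: "module_hom scale scale (dv v)"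
  by (intro chain_linearI poly_mapping_eqI)
     (simp_all add: lookup_dv lookup_scale plus_poly_mapping.rep_eq dv_coeff_add dv_coeff_mult)

lemma dv_anticommute: "dv u (dv v x) = scale (- 1) (dv v (dv u x))"
  by (rule poly_mapping_eqI) (simp add: lookup_dv lookup_scale dv_coeff_anticommute[of u])

lemma lookup_dv_nonzeroE:
  assumes "Poly_Mapping.lookup (dv v x) w \<noteq> 0"
  obtains w1 w2 where "w = w1 @ v # w2" "Poly_Mapping.lookup x (w1 @ w2) \<noteq> 0"
proof -
  have "dv_coeff v (Poly_Mapping.lookup x) w = 0"
    if "\<And>w1 w2. w = w1 @ v # w2 \<Longrightarrow> Poly_Mapping.lookup x (w1 @ w2) = 0"
    using that dv_coeff_cong[of w v "Poly_Mapping.lookup x" "\<lambda>_. 0"] dv_coeff_mult[of v 0]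
    by simp
  then show thesis
    using assms that by (auto simp: lookup_dv)
qed

text \<open>Provides what membership in \<open>L\<close> requires: a path in the result contains the
  vertices of a path \<open>u\<close> of \<open>x\<close>, so upward closure can apply, and the
  lengths fix the degree.\<close>

lemma lookup_foldr_dv_nonzeroE:
  assumes "Poly_Mapping.lookup (foldr dv vs x) w \<noteq> 0"
  obtains u where "Poly_Mapping.lookup x u \<noteq> 0" "set w = set u \<union> set vs"
    "length w = length u + length vs"
  using assms
proof (induction vs arbitrary: w thesis)
  case (Cons v vs)
  from Cons.prems(2) have "Poly_Mapping.lookup (dv v (foldr dv vs x)) w \<noteq> 0" by simp
  then obtain w1 w2 where w: "w = w1 @ v # w2" "Poly_Mapping.lookup (foldr dv vs x) (w1 @ w2) \<noteq> 0"
    by (rule lookup_dv_nonzeroE)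
  obtain u where u: "Poly_Mapping.lookup x u \<noteq> 0" "set (w1 @ w2) = set u \<union> set vs"
    "length (w1 @ w2) = length u + length vs"
    using Cons.IH[OF _ w(2)] by blast
  show ?case
  proof (rule Cons.prems(1))
    show "Poly_Mapping.lookup x u \<noteq> 0" by (rule u)
    have "set w = insert v (set (w1 @ w2))"
      by (auto simp: w(1))
    then show "set w = set u \<union> set (v # vs)"
      by (simp only: u(2)) simp
    show "length w = length u + length (v # vs)"
      using u(3) by (simp add: w(1))
  qed
qed simp

lemma linear_foldr_dv: "module_hom scale scale (foldr dv vs)"
proof (induction vs)
  case (Cons v vs)
  then show ?case
    by (intro chain_linearI)
       (simp_all add: module_hom.add[OF linear_dv] module_hom.scale[OF linear_dv]
          module_hom.add[OF Cons.IH] module_hom.scale[OF Cons.IH])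
qed (auto intro: chain_linearI)

section \<open>Graded commutation in the exterior algebra\<close>

lemma dv_foldr_dv:
  "dv v (foldr dv ws x) = scale ((- 1) ^ length ws) (foldr dv ws (dv v x))"
proof (induction ws)
  case (Cons w ws)
  then show ?case
    by (simp add: dv_anticommute[of v w] module_hom.scale[OF linear_dv] chain.scale_scale
        del: chain.scale_minus_left)
qed simp

text \<open>Each factor of \<open>vs\<close> moves past all of \<open>ws\<close>, at the cost of one
  sign per factor of \<open>ws\<close>.\<close>

lemma foldr_dv_commute:
  "foldr dv vs (foldr dv ws x) =
     scale ((- 1) ^ (length vs * length ws)) (foldr dv ws (foldr dv vs x))"
proof (induction vs)
  case (Cons v vs)
  then show ?case
    by (simp add: dv_foldr_dv[of v ws] module_hom.scale[OF linear_dv] power_add mult.commute)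
qed simp

lemma ext_powerE:
  assumes "\<omega> \<in> ext_power V k"
  obtains c where "\<omega> = (\<lambda>x. \<Sum>vs | set vs \<subseteq> V \<and> length vs = k. scale (c vs) (foldr dv vs x))"
  using assms by (auto simp: ext_power_def)

lemma linear_ext_power:
  assumes "\<omega> \<in> ext_power V k"
  shows "module_hom scale scale \<omega>"
  using assms
  by (elim ext_powerE, intro chain_linearI)
     (simp_all add: module_hom.add[OF linear_foldr_dv] module_hom.scale[OF linear_foldr_dv]
        chain.scale_right_distrib sum.distrib chain.scale_sum_right mult.commute)

text \<open>By bilinearity the claim reduces to the spanning compositions, which all pick up the
  same sign.\<close>

lemma ext_power_commute:
  assumes "\<omega> \<in> ext_power V j" and "\<mu> \<in> ext_power V k"
  shows "\<omega> (\<mu> x) = scale ((- 1) ^ (j * k)) (\<mu> (\<omega> x))"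
proof -
  let ?W = "\<lambda>k. {vs. set vs \<subseteq> V \<and> length vs = k}"
  obtain c where \<omega>: "\<omega> = (\<lambda>x. \<Sum>vs\<in>?W j. scale (c vs) (foldr dv vs x))"
    using assms(1) by (rule ext_powerE)
  obtain d where \<mu>: "\<mu> = (\<lambda>x. \<Sum>vs\<in>?W k. scale (d vs) (foldr dv vs x))"
    using assms(2) by (rule ext_powerE)
  note lin = module_hom.sum[OF linear_foldr_dv] module_hom.scale[OF linear_foldr_dv]
  have "\<omega> (\<mu> x) = (\<Sum>vs\<in>?W j. \<Sum>ws\<in>?W k. scale (c vs * d ws) (foldr dv vs (foldr dv ws x)))"
    by (simp add: \<omega> \<mu> lin chain.scale_sum_right)
  also have "\<dots> = (\<Sum>vs\<in>?W j. \<Sum>ws\<in>?W k.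
      scale ((- 1) ^ (j * k)) (scale (d ws * c vs) (foldr dv ws (foldr dv vs x))))"
    by (intro sum.cong refl, subst foldr_dv_commute) (simp add: mult_ac)
  also have "\<dots> = (\<Sum>ws\<in>?W k. \<Sum>vs\<in>?W j.
      scale ((- 1) ^ (j * k)) (scale (d ws * c vs) (foldr dv ws (foldr dv vs x))))"
    by (rule sum.swap)
  also have "\<dots> = scale ((- 1) ^ (j * k)) (\<mu> (\<omega> x))"
    by (simp add: \<omega> \<mu> lin chain.scale_sum_right)
  finally show ?thesis .
qed

section \<open>The action modulo non-simplicial paths\<close>

lemma non_simplicial_iff:
  "non_simplicial r p \<longleftrightarrow> \<not> sorted_wrt (\<lambda>u v. (v, u) \<notin> r \<and> v \<noteq> u) p"
  by (auto simp: non_simplicial_def sorted_wrt_iff_nth_less)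

lemma linear_kill: "module_hom scale scale (kill_non_simplicial r)"
  by (intro chain_linearI poly_mapping_eqI)
     (simp_all add: lookup_kill lookup_scale lookup_add)

text \<open>Deleting a vertex from a simplicial path leaves it simplicial, so paths killed early
  contribute only to coefficients that are killed in the end.\<close>

lemma kill_dv_kill:
  "kill_non_simplicial r (dv v (kill_non_simplicial r x)) = kill_non_simplicial r (dv v x)"
proof (rule poly_mapping_eqI)
  fix w
  show "Poly_Mapping.lookup (kill_non_simplicial r (dv v (kill_non_simplicial r x))) w =
      Poly_Mapping.lookup (kill_non_simplicial r (dv v x)) w"
  proof (cases "non_simplicial r w")
    case False
    then have "dv_coeff v (Poly_Mapping.lookup (kill_non_simplicial r x)) w =
        dv_coeff v (Poly_Mapping.lookup x) w"
      by (intro dv_coeff_cong) (auto simp: lookup_kill non_simplicial_iff sorted_wrt_append)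
    with False show ?thesis
      by (simp add: lookup_kill lookup_dv)
  qed (simp add: lookup_kill)
qed

lemma kill_foldr_dv_kill:
  "kill_non_simplicial r (foldr dv vs (kill_non_simplicial r x)) =
     kill_non_simplicial r (foldr dv vs x)"
proof (induction vs)
  case Nil
  show ?case by (simp add: poly_mapping_eq_iff fun_eq_iff lookup_kill)
next
  case (Cons v vs)
  then show ?case
    using kill_dv_kill[of r v "foldr dv vs _"] by (metis foldr_Cons comp_apply)
qed

text \<open>The outer killing absorbs the inner one, so identities between compositions on all
  chains descend to the action.\<close>

lemma ext_action_ext_action:
  assumes "\<omega> \<in> ext_power V k"
  shows "ext_action r \<omega> (ext_action r \<mu> x) = kill_non_simplicial r (\<omega> (\<mu> x))"
  using assms
  by (elim ext_powerE)
     (simp add: ext_action_def module_hom.sum[OF linear_kill] module_hom.scale[OF linear_kill]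
        kill_foldr_dv_kill)

lemma linear_ext_action:
  assumes "\<omega> \<in> ext_power V k"
  shows "module_hom scale scale (ext_action r \<omega>)"
  using linear_ext_power[OF assms] linear_kill[of r]
  by (intro chain_linearI) (simp_all add: ext_action_def module_hom.add module_hom.scale)

lemma ext_action_commute:
  assumes "\<omega> \<in> ext_power V j" and "\<mu> \<in> ext_power V k"
  shows "ext_action r \<omega> (ext_action r \<mu> x) =
    scale ((- 1) ^ (j * k)) (ext_action r \<mu> (ext_action r \<omega> x))"
  by (simp add: ext_action_ext_action[OF assms(1)] ext_action_ext_action[OF assms(2)]
      ext_power_commute[OF assms] module_hom.scale[OF linear_kill])

text \<open>The sign exponent \<open>k * k\<close> is odd, so the square equals its own negative,
  which forces 0 over the reals.\<close>

lemma ext_action_odd_square: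
  assumes "\<omega> \<in> ext_power V k" and "odd k"
  shows "ext_action r \<omega> (ext_action r \<omega> x) = 0"
proof -
  let ?y = "ext_action r \<omega> (ext_action r \<omega> x)"
  have "?y = scale (- 1) ?y"
    using ext_action_commute[OF assms(1,1), of r x] assms(2) by simp
  then have "Poly_Mapping.lookup ?y w = - Poly_Mapping.lookup ?y w" for w
    by (metis lookup_scale mult_minus1)
  then show ?thesis
    by (intro poly_mapping_eqI) simp
qed

section \<open>Chains of an independent hypergraph and the cochain spaces\<close>

lemma mem_chains_iff:
  "x \<in> chains L n \<longleftrightarrow>
     (\<forall>w. Poly_Mapping.lookup x w \<noteq> 0 \<longrightarrow> w \<in> L \<and> w \<noteq> [] \<and> int (length w) = n + 1)"
  by (auto simp: chains_def in_keys_iff)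

text \<open>Totality of the order turns a surviving simplicial path with vertices in
  \<open>V\<close> into a hyperedge. It contains a member of \<open>L\<close>, so independence puts
  it in \<open>L\<close>.\<close>

lemma ext_action_chains:
  assumes r: "strict_linear_order_on V r" and L: "independent_hypergraph V r L"
    and \<omega>: "\<omega> \<in> ext_power V k" and x: "x \<in> chains L n"
  shows "ext_action r \<omega> x \<in> chains L (n + int k)"
  unfolding mem_chains_iff
proof (intro allI impI)
  fix w assume "Poly_Mapping.lookup (ext_action r \<omega> x) w \<noteq> 0"
  then have simplicial: "\<not> non_simplicial r w" and w: "Poly_Mapping.lookup (\<omega> x) w \<noteq> 0"
    by (auto simp: ext_action_def lookup_kill split: if_splits)
  obtain c where "\<omega> = (\<lambda>x. \<Sum>vs | set vs \<subseteq> V \<and> length vs = k. scale (c vs) (foldr dv vs x))"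
    using \<omega> by (rule ext_powerE)
  with w obtain vs where vs: "set vs \<subseteq> V" "length vs = k"
      "Poly_Mapping.lookup (foldr dv vs x) w \<noteq> 0"
    by (auto simp: lookup_sum lookup_scale elim!: sum.not_neutral_contains_not_neutral)
  obtain u where "Poly_Mapping.lookup x u \<noteq> 0" and set_w: "set w = set u \<union> set vs"
      and len_w: "length w = length u + length vs"
    using vs(3) by (rule lookup_foldr_dv_nonzeroE)
  with x have u: "u \<in> L" "u \<noteq> []" "int (length u) = n + 1"
    by (auto simp: mem_chains_iff)
  then have "set u \<subseteq> V"
    using L by (auto simp: independent_hypergraph_def hyperedges_def)
  with set_w vs(1) have "set w \<subseteq> V" by simp
  moreover have "sorted_wrt (\<lambda>u v. (u, v) \<in> r) w"
  proof (rule sorted_wrt_mono_rel)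
    show "sorted_wrt (\<lambda>u v. (v, u) \<notin> r \<and> v \<noteq> u) w"
      using simplicial by (simp add: non_simplicial_iff)
    show "(a, b) \<in> r" if "a \<in> set w" "b \<in> set w" "(b, a) \<notin> r \<and> b \<noteq> a" for a b
      using r that \<open>set w \<subseteq> V\<close> by (auto simp: strict_linear_order_on_def total_on_def)
  qed
  moreover have "w \<noteq> []"
    using len_w u(2) by auto
  ultimately have "w \<in> hyperedges V r"
    by (simp add: hyperedges_def)
  then have "w \<in> L"
    using L u(1) set_w by (auto simp: independent_hypergraph_def)
  then show "w \<in> L \<and> w \<noteq> [] \<and> int (length w) = n + int k + 1"
    using \<open>w \<noteq> []\<close> len_w u(3) vs(2) by simp
qed

text \<open>Quotient and remainder recombine to \<open>m\<close>. Thus adding to \<open>m\<close>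
  just raises the chain degree, even when the remainder wraps around.\<close>

lemma cochain_space_eq: "cochain_space L t m n = chains L (int n * (2 * int t + 1) + m)"
  by (simp add: cochain_space_def Let_def distrib_right add.assoc)

lemma subspace_cochain_space: "chain.subspace (cochain_space L t m n)"
proof (rule chain.subspaceI)
  show "x + y \<in> cochain_space L t m n"
    if "x \<in> cochain_space L t m n" "y \<in> cochain_space L t m n" for x y
    using that unfolding cochain_space_eq mem_chains_iff lookup_add by (metis add_0)
qed (auto simp: cochain_space_eq mem_chains_iff lookup_scale)

lemma ext_action_cochain_space_Suc:
  assumes "strict_linear_order_on V r" and "independent_hypergraph V r L"
    and "\<omega> \<in> ext_power V (2 * t + 1)" and "x \<in> cochain_space L t m n"
  shows "ext_action r \<omega> x \<in> cochain_space L t m (Suc n)"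
  using ext_action_chains[OF assms(1-3), of x "int n * (2 * int t + 1) + m"] assms(4)
  by (simp add: cochain_space_eq algebra_simps)

lemma ext_action_cochain_space_shift:
  assumes "strict_linear_order_on V r" and "independent_hypergraph V r L"
    and "\<mu> \<in> ext_power V j" and "x \<in> cochain_space L t m n"
  shows "ext_action r \<mu> x \<in> cochain_space L t (m + int j) n"
  using ext_action_chains[OF assms(1-3), of x "int n * (2 * int t + 1) + m"] assms(4)
  by (simp add: cochain_space_eq algebra_simps)

section \<open>Cocycles, coboundaries and their quotient groups\<close>

lemma subspace_cocycles:
  assumes "\<omega> \<in> ext_power V k"
  shows "chain.subspace (cocycles r L t \<omega> m n)"
proof -
  have "cocycles r L t \<omega> m n = cochain_space L t m n \<inter> {x. ext_action r \<omega> x = 0}"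
    by (auto simp: cocycles_def)
  then show ?thesis
    using chain.subspace_inter[OF subspace_cochain_space
        module_hom.subspace_kernel[OF linear_ext_action[OF assms]]] by simp
qed

lemma subspace_coboundaries:
  assumes "\<omega> \<in> ext_power V k"
  shows "chain.subspace (coboundaries r L t \<omega> m n)"
  using module_hom.subspace_image[OF linear_ext_action[OF assms] subspace_cochain_space]
  by (simp add: coboundaries_def chain.subspace_single_0 split: nat.split)

text \<open>In positive degree this is the vanishing of the square of \<open>\<omega>\<close>; in
  degree 0 only the zero chain is concerned.\<close>

lemma coboundaries_subset_cocycles:
  assumes "strict_linear_order_on V r" and "independent_hypergraph V r L"
    and \<omega>: "\<omega> \<in> ext_power V (2 * t + 1)"
  shows "coboundaries r L t \<omega> m n \<subseteq> cocycles r L t \<omega> m n"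
  using chain.subspace_0[OF subspace_cocycles[OF \<omega>]]
    ext_action_cochain_space_Suc[OF assms] ext_action_odd_square[OF \<omega>]
  by (auto simp: coboundaries_def cocycles_def split: nat.splits)

text \<open>Serves for both cocycles and coboundaries, as additive groups.\<close>

lemma comm_group_chain_subspace:
  assumes "chain.subspace S"
  shows "comm_group \<lparr>carrier = S, mult = (+), one = 0\<rparr>"
proof (rule comm_groupI)
  show "\<exists>y\<in>carrier \<lparr>carrier = S, mult = (+), one = 0\<rparr>.
      y \<otimes>\<^bsub>\<lparr>carrier = S, mult = (+), one = 0\<rparr>\<^esub> x = \<one>\<^bsub>\<lparr>carrier = S, mult = (+), one = 0\<rparr>\<^esub>"
    if "x \<in> carrier \<lparr>carrier = S, mult = (+), one = 0\<rparr>" for x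
    using that chain.subspace_neg[OF assms] by (auto intro!: bexI[of _ "- x"])
qed (auto simp: add_ac chain.subspace_add[OF assms] chain.subspace_0[OF assms])

lemma coboundaries_normal:
  assumes "strict_linear_order_on V r" and "independent_hypergraph V r L"
    and \<omega>: "\<omega> \<in> ext_power V (2 * t + 1)"
  shows "coboundaries r L t \<omega> m n \<lhd> cocycle_group r L t \<omega> m n"
proof -
  interpret Z: comm_group "cocycle_group r L t \<omega> m n"
    unfolding cocycle_group_def
    by (rule comm_group_chain_subspace[OF subspace_cocycles[OF \<omega>]])
  have "group (cocycle_group r L t \<omega> m n \<lparr>carrier := coboundaries r L t \<omega> m n\<rparr>)"
    using comm_group_chain_subspace[OF subspace_coboundaries[OF \<omega>]]
    by (simp add: cocycle_group_def comm_group_def)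
  then have "subgroup (coboundaries r L t \<omega> m n) (cocycle_group r L t \<omega> m n)"
    using coboundaries_subset_cocycles[OF assms]
    by (intro Z.group_incl_imp_subgroup) (auto simp: cocycle_group_def)
  then show ?thesis
    by (rule Z.subgroup_imp_normal)
qed

theorem theorem4p8:
  fixes V :: "'a set" and r :: "'a rel" and L :: "'a list set"
    and t s n :: nat and m lam q :: int
    and \<omega> \<mu> :: "'a chain \<Rightarrow> 'a chain"
  assumes "finite V"
    and "strict_linear_order_on V r"
    and "independent_hypergraph V r L"
    and "m = lam * (2 * int t + 1) + q" and "0 \<le> q" and "q \<le> 2 * int t"
    and "\<omega> \<in> ext_power V (2 * t + 1)"
    and "\<mu> \<in> ext_power V (2 * s)"
  shows "\<exists>f \<in> hom (constrained_cohomology r L t \<omega> m n)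
                   (constrained_cohomology r L t \<omega> (m + 2 * int s) n).
           \<forall>x \<in> cocycles r L t \<omega> m n.
             ext_action r \<mu> x \<in> cocycles r L t \<omega> (m + 2 * int s) n \<and>
             f (cohomology_class r L t \<omega> m n x)
               = cohomology_class r L t \<omega> (m + 2 * int s) n (ext_action r \<mu> x)"
proof -
  let ?m = "m + 2 * int s"
  let ?Z = "cocycle_group r L t \<omega> m n" and ?Z' = "cocycle_group r L t \<omega> ?m n"
  let ?B = "coboundaries r L t \<omega> m n" and ?B' = "coboundaries r L t \<omega> ?m n"
  let ?\<mu> = "ext_action r \<mu>" and ?\<omega> = "ext_action r \<omega>"
  note r = assms(2) and L = assms(3) and \<omega> = assms(7) and \<mu> = assms(8)
  \<comment> \<open>The exponent \<open>(2 * t + 1) * (2 * s)\<close> is even, so the sign is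
    1.\<close>
  have commute: "?\<omega> (?\<mu> x) = ?\<mu> (?\<omega> x)" for x
    by (simp add: ext_action_commute[OF \<omega> \<mu>])
  note \<mu>_lin = linear_ext_action[OF \<mu>, of r]
  have shift: "?\<mu> x \<in> cochain_space L t ?m k" if "x \<in> cochain_space L t m k" for x k
    using ext_action_cochain_space_shift[OF r L \<mu> that] by simp
  have cocycle: "?\<mu> x \<in> cocycles r L t \<omega> ?m n" if "x \<in> cocycles r L t \<omega> m n" for x
    using that shift[of x n] by (simp add: cocycles_def commute module_hom.zero[OF \<mu>_lin])
  \<comment> \<open>For \<open>n = Suc k\<close> a primitive in degree \<open>k\<close> is carried
    by \<open>?\<mu>\<close> to a primitive of the image; for \<open>n = 0\<close> only
    \<open>?\<mu> 0 = 0\<close> is needed.\<close>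
  have coboundary: "?\<mu> x \<in> ?B'" if "x \<in> ?B" for x
    using that shift
    by (auto simp: coboundaries_def commute[symmetric] module_hom.zero[OF \<mu>_lin] split: nat.splits)
  have B: "?B \<lhd> ?Z" and B': "?B' \<lhd> ?Z'"
    using coboundaries_normal[OF r L \<omega>] by blast+
  interpret Z: group ?Z using B by (rule normal.axioms(2))
  interpret B': normal ?B' ?Z' by (rule B')
  have "?\<mu> \<in> hom ?Z ?Z'"
    using cocycle by (auto simp: hom_def cocycle_group_def module_hom.add[OF \<mu>_lin])
  \<comment> \<open>Following \<open>?\<mu>\<close> by the projection onto the target quotient gives
    a homomorphism on cocycles, which is then factored through \<open>?Z Mod ?B\<close>.\<close>
  then have "(\<lambda>x. ?B' #>\<^bsub>?Z'\<^esub> x) \<circ> ?\<mu> \<in> hom ?Z (?Z' Mod ?B')"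
    using B'.r_coset_hom_Mod by (rule hom_compose)
  then interpret h: group_hom ?Z "?Z' Mod ?B'" "(\<lambda>x. ?B' #>\<^bsub>?Z'\<^esub> x) \<circ> ?\<mu>"
    by (intro group_hom.intro group_hom_axioms.intro Z.group_axioms B'.factorgroup_is_group)
  \<comment> \<open>A coboundary goes to a coboundary, whose coset is \<open>?B'\<close>, the
    identity of the quotient.\<close>
  have "?B \<subseteq> kernel ?Z (?Z' Mod ?B') ((\<lambda>x. ?B' #>\<^bsub>?Z'\<^esub> x) \<circ> ?\<mu>)"
    using coboundary B'.rcos_const[OF B'.is_group] normal_imp_subgroup[OF B] subgroup.subset
    by (fastforce simp: kernel_def)
  then obtain f where "f \<in> hom (?Z Mod ?B) (?Z' Mod ?B')"
      and "\<And>x. x \<in> carrier ?Z \<Longrightarrow> f (?B #>\<^bsub>?Z\<^esub> x) = ((\<lambda>x. ?B' #>\<^bsub>?Z'\<^esub> x) \<circ> ?\<mu>) x"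
    using h.FactGroup_universal_kernel[OF B] by blast
  then show ?thesis
    using cocycle
    by (intro bexI[of _ f])
       (auto simp: constrained_cohomology_def cohomology_class_def cocycle_group_def)
qed

end
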